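(* Let $k\geq 3$ be an integer, let $S$ be a set of integers containing no arithmetic progression of length $k$, and let $c = \frac{k}{k-1}$. Then there is $N_0$ such that for every $N \ge N_0$: if $a_0$ is a non-negative integer and $A=\{a_1, \ldots, a_d\}$ is a set of positive integers such that $H(a_0; a_1, \ldots , a_d) \subset S\cap [1,N]$, then \[ d \leq \frac{2(k-2)}{(k-1)\log c}\log N+\frac{2}{\log c}+1. \]
   Context: An arithmetic progression of length $k$ is a set $\{b, b+h, \dots, b+(k-1)h\}$ with $b,h$ integers and $h\neq 0$. For integers $a_0\neq 0, a_1,\dots,a_d$, the Hilbert cube is $H(a_0;a_1,\dots,a_d)=\{a_0+\sum_{i=1}^d \varepsilon_i a_i : \varepsilon_i\in\{0,1\}\}$; for $a_0=0$ the empty sum is excluded: $H(0;a_1,\dots,a_d)=\{\sum_{i=1}^d \varepsilon_i a_i : \varepsilon_i\in\{0,1\},\ \sum_i \varepsilon_i>0\}$. $\log$ is the natural logarithm. *)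

theory Defs
  imports Complex_Main
begin

definition is_AP :: "nat \<Rightarrow> int set \<Rightarrow> bool" where
  "is_AP k P \<longleftrightarrow> (\<exists>b h. h \<noteq> 0 \<and> P = {b + int i * h | i. i < k})"

definition contains_AP :: "nat \<Rightarrow> int set \<Rightarrow> bool" where
  "contains_AP k S \<longleftrightarrow> (\<exists>P \<subseteq> S. is_AP k P)"

text \<open>
  \<open>hilbert_cube a0 d a\<close> is the cube $H(a_0; a_1, \dots, a_d)$; only the values
  \<open>a 1, \<dots>, a d\<close> matter.  For \<open>a0 = 0\<close> the choice of all coefficients equal to
  zero is excluded.
\<close>

definition hilbert_cube :: "int \<Rightarrow> nat \<Rightarrow> (nat \<Rightarrow> int) \<Rightarrow> int set" where
  "hilbert_cube a0 d a =
     {a0 + (\<Sum>i=1..d. \<epsilon> i * a i) | \<epsilon> :: nat \<Rightarrow> int.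
        (\<forall>i\<in>{1..d}. \<epsilon> i \<in> {0, 1}) \<and> (a0 = 0 \<longrightarrow> (\<Sum>i=1..d. \<epsilon> i) > 0)}"

end

theory Submission
  imports Defs
begin

text \<open>
  Adjoining a generator \<open>h\<close> turns a cube \<open>H\<close> into a superset of \<open>H \<union> (H + h)\<close>.  If \<open>H\<close> has no
  progression of length \<open>k\<close>, it splits into chains of difference \<open>h\<close> with at most \<open>k - 1\<close>
  elements, and each chain gains an element, so the cardinality grows at least by the factor
  \<open>c = k / (k - 1)\<close>.  Hence \<open>c ^ (d - 1) \<le> N\<close>, i.e. \<open>d \<le> ln N / ln c + 1\<close>, which implies the
  claimed bound because \<open>1 \<le> 2 (k - 2) / (k - 1)\<close> for \<open>k \<ge> 3\<close>.
\<close>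

text \<open>Walking from a point of \<open>H\<close> in steps of \<open>h\<close>, one leaves
  \<open>H\<close> within \<open>k - 1\<close> steps, and the first point outside lies in the shift
  of \<open>H\<close> minus \<open>H\<close>. So \<open>k - 1\<close> translates of that difference
  cover \<open>H\<close>.\<close>

lemma card_le_card_shift_diff:
  fixes H :: "int set"
  assumes fin: "finite H" and h: "h \<noteq> 0" and free: "\<not> contains_AP k H"
  shows "card H \<le> (k - 1) * card ((\<lambda>x. x + h) ` H - H)"
proof -
  let ?B = "(\<lambda>x. x + h) ` H - H"
  have "H \<subseteq> (\<Union>n\<in>{1..k - 1}. (\<lambda>y. y - int n * h) ` ?B)"
  proof
    fix x assume x: "x \<in> H"
    have "\<not> {x + int i * h | i. i < k} \<subseteq> H"
      using free h unfolding contains_AP_def is_AP_def by blast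
    then obtain i where i: "i < k" "x + int i * h \<notin> H" by auto
    define n where "n = (LEAST i. x + int i * h \<notin> H)"
    have n: "x + int n * h \<notin> H" "n \<le> i"
      unfolding n_def using i(2) by (rule LeastI, rule Least_le)
    have "n \<noteq> 0" using n(1) x by (intro notI) simp
    then obtain m where m: "n = Suc m" by (cases n) auto
    have "x + int m * h \<in> H"
      \<comment> \<open>By minimality of \<open>n\<close> the predecessor is still in
        \<open>H\<close>, which makes the exit point a shift by \<open>h\<close> of an element of
        \<open>H\<close>.\<close>
      using not_less_Least[of m "\<lambda>i. x + int i * h \<notin> H"] m unfolding n_def by simp
    then have "x + int n * h \<in> ?B"
      using n(1) m by (auto simp: image_iff algebra_simps intro!: bexI[of _ "x + int m * h"])
    moreover have "n \<in> {1..k - 1}" using n(2) i(1) m by auto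
    ultimately show "x \<in> (\<Union>n\<in>{1..k - 1}. (\<lambda>y. y - int n * h) ` ?B)"
      by (intro UN_I[of n] image_eqI[of _ _ "x + int n * h"]) auto
  qed
  then have "card H \<le> card (\<Union>n\<in>{1..k - 1}. (\<lambda>y. y - int n * h) ` ?B)"
    using fin by (intro card_mono) auto
  also have "\<dots> \<le> (\<Sum>n\<in>{1..k - 1}. card ((\<lambda>y. y - int n * h) ` ?B))"
    by (intro card_UN_le) auto
  also have "\<dots> \<le> (\<Sum>n\<in>{1..k - 1}. card ?B)"
    using fin by (intro sum_mono card_image_le) auto
  finally show ?thesis by simp
qed

text \<open>The inclusions correspond to the new coefficient being 0 or 1. It is nonnegative, so for
  \<open>a0 = 0\<close> a positive coefficient sum stays positive.\<close>

lemma hilbert_cube_Suc: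
  "hilbert_cube a0 d a \<subseteq> hilbert_cube a0 (Suc d) a"
  "(\<lambda>x. x + a (Suc d)) ` hilbert_cube a0 d a \<subseteq> hilbert_cube a0 (Suc d) a"
proof -
  have *: "x + e * a (Suc d) \<in> hilbert_cube a0 (Suc d) a"
    if x: "x \<in> hilbert_cube a0 d a" and e: "e \<in> {0, 1}" for x e
  proof -
    obtain f :: "nat \<Rightarrow> int" where f: "x = a0 + (\<Sum>i=1..d. f i * a i)"
      "\<forall>i\<in>{1..d}. f i \<in> {0, 1}" "a0 = 0 \<longrightarrow> (\<Sum>i=1..d. f i) > 0"
      using x unfolding hilbert_cube_def by blast
    let ?g = "f(Suc d := e)"
    have "(\<Sum>i=1..d. ?g i * a i) = (\<Sum>i=1..d. f i * a i)" "(\<Sum>i=1..d. ?g i) = (\<Sum>i=1..d. f i)"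
      by (auto intro!: sum.cong)
    then have "x + e * a (Suc d) = a0 + (\<Sum>i=1..Suc d. ?g i * a i)"
      "\<forall>i\<in>{1..Suc d}. ?g i \<in> {0, 1}" "a0 = 0 \<longrightarrow> (\<Sum>i=1..Suc d. ?g i) > 0"
      using f e by (auto simp: le_Suc_eq)
    then show ?thesis unfolding hilbert_cube_def by blast
  qed
  show "hilbert_cube a0 d a \<subseteq> hilbert_cube a0 (Suc d) a"
    using *[where e = 0] by auto
  show "(\<lambda>x. x + a (Suc d)) ` hilbert_cube a0 d a \<subseteq> hilbert_cube a0 (Suc d) a"
    using *[where e = 1] by auto
qed

text \<open>The exponent starts at dimension one, since \<open>hilbert_cube 0 0 a\<close> is empty.\<close>

lemma card_hilbert_cube_ge:
  fixes a :: "nat \<Rightarrow> int"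
  assumes k: "k \<ge> 2" and fin: "finite T" and free: "\<not> contains_AP k T"
    and sub: "hilbert_cube a0 (Suc j) a \<subseteq> T" and nz: "\<forall>i\<in>{1..Suc j}. a i \<noteq> 0"
  shows "(real k / (real k - 1)) ^ j \<le> real (card (hilbert_cube a0 (Suc j) a))"
  using sub nz
proof (induction j)
  case 0
  \<comment> \<open>Coefficient 1 is admissible for every \<open>a0\<close>, including 0.\<close>
  have "a0 + a 1 \<in> hilbert_cube a0 (Suc 0) a"
    unfolding hilbert_cube_def by (auto intro!: exI[of _ "\<lambda>_. 1"])
  then have "card (hilbert_cube a0 (Suc 0) a) > 0"
    using 0 fin finite_subset by (fastforce simp: card_gt_0_iff)
  then show ?case by simp
next
  case (Suc j)
  let ?H = "hilbert_cube a0 (Suc j) a" and ?H' = "hilbert_cube a0 (Suc (Suc j)) a"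
  let ?B = "(\<lambda>x. x + a (Suc (Suc j))) ` ?H - ?H"
  have fin': "finite ?H'" using Suc.prems(1) fin finite_subset by blast
  have HH': "?H \<union> ?B \<subseteq> ?H'"
    using hilbert_cube_Suc[where d = "Suc j"] by blast
  then have HT: "?H \<subseteq> T" and finH: "finite ?H" using Suc.prems(1) fin' finite_subset by auto
  have "\<not> contains_AP k ?H" using free HT unfolding contains_AP_def by blast
  then have "card ?H \<le> (k - 1) * card ?B"
    using card_le_card_shift_diff finH Suc.prems(2) by auto
  then have "real (card ?H) \<le> real ((k - 1) * card ?B)" by (simp only: of_nat_le_iff)
  then have B: "real (card ?H) \<le> (real k - 1) * real (card ?B)"
    using k by (simp add: of_nat_diff)
  have "card ?H + card ?B = card (?H \<union> ?B)"
    using finH by (intro card_Un_disjoint[symmetric]) auto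
  also have "\<dots> \<le> card ?H'" by (intro card_mono fin' HH')
  finally have H': "real (card ?H) + real (card ?B) \<le> real (card ?H')" by linarith
  have IH: "(real k / (real k - 1)) ^ j \<le> real (card ?H)"
    using Suc.IH Suc.prems(2) HT by auto
  have "(real k / (real k - 1)) ^ Suc j \<le> real k / (real k - 1) * real (card ?H)"
    using IH k by (simp add: mult_left_mono del: times_divide_eq_left)
  \<comment> \<open>The growth factor is 1 + 1/(k - 1); its second part is paid for by the new
    points, through \<open>B\<close>.\<close>
  also have "\<dots> = real (card ?H) + real (card ?H) / (real k - 1)"
    using k by (simp add: field_simps)
  also have "\<dots> \<le> real (card ?H) + real (card ?B)"
    using B k by (simp add: field_simps)
  finally show ?case using H' by linarith
qed

theorem theorem2:
  fixes k :: nat and S :: "int set" and c :: real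
  assumes "k \<ge> 3"
    and "\<not> contains_AP k S"
    and "c = real k / (real k - 1)"
  shows "\<exists>N0::nat. \<forall>N\<ge>N0. \<forall>(a0::int) (d::nat) (a::nat \<Rightarrow> int).
           a0 \<ge> 0 \<longrightarrow> inj_on a {1..d} \<longrightarrow> (\<forall>i\<in>{1..d}. a i > 0) \<longrightarrow>
           hilbert_cube a0 d a \<subseteq> S \<inter> {1..int N} \<longrightarrow>
           real d \<le> 2 * (real k - 2) / ((real k - 1) * ln c) * ln (real N) + 2 / ln c + 1"
\<comment> \<open>The threshold 1 ensures that \<open>ln (real N)\<close> is nonnegative.\<close>
proof (intro exI[of _ 1] allI impI)
  fix N :: nat and a0 :: int and d :: nat and a :: "nat \<Rightarrow> int"
  assume N: "1 \<le> N" and pos: "\<forall>i\<in>{1..d}. a i > 0"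
    and sub: "hilbert_cube a0 d a \<subseteq> S \<inter> {1..int N}"
  have "c > 1" using assms(1,3) by simp
  then have lnc: "ln c > 0" by simp
  have lnN: "ln (real N) \<ge> 0" using N by simp
  have "real d - 1 \<le> ln (real N) / ln c"
  proof (cases d)
    case 0
    have "0 \<le> ln (real N) / ln c" using lnc lnN by simp
    then show ?thesis using 0 by simp
  next
    case (Suc j)
    \<comment> \<open>Intersecting with the interval gives the finite set that the growth bound
      requires.\<close>
    have free: "\<not> contains_AP k (S \<inter> {1..int N})"
      using assms(2) unfolding contains_AP_def by blast
    have "c ^ j \<le> real (card (hilbert_cube a0 d a))"
      using card_hilbert_cube_ge[OF _ _ free, of a0 j a] sub pos assms(1,3) Suc by fastforce
    also have "card (hilbert_cube a0 d a) \<le> card {1..int N}"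
      using sub by (intro card_mono) auto
    then have "real (card (hilbert_cube a0 d a)) \<le> real N" by simp
    finally have "ln (c ^ j) \<le> ln (real N)"
      using \<open>c > 1\<close> N by (subst ln_le_cancel_iff) auto
    then have "real j * ln c \<le> ln (real N)" using \<open>c > 1\<close> by (simp add: ln_realpow)
    then show ?thesis using lnc Suc by (simp add: field_simps)
  qed
  also have "\<dots> \<le> (2 * (real k - 2) / (real k - 1)) * (ln (real N) / ln c)"
  proof -
    \<comment> \<open>This amounts to k \<ge> 3.\<close>
    have "1 \<le> 2 * (real k - 2) / (real k - 1)" using assms(1) by (simp add: field_simps)
    from mult_right_mono[OF this, of "ln (real N) / ln c"] show ?thesis using lnc lnN by simp
  qed
  also have "\<dots> = 2 * (real k - 2) / ((real k - 1) * ln c) * ln (real N)" by simp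
  finally show "real d \<le> 2 * (real k - 2) / ((real k - 1) * ln c) * ln (real N) + 2 / ln c + 1"
    using divide_pos_pos[of 2, OF _ lnc] by linarith
qed

end
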